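(* Let $\varphi$, $\psi$ be linear groupoid identities, and let $2m$ be the length of $\psi$. Then $\varphi$ implies $\psi$ if and only if $\psi$ corresponds to a journey through the identity-hedron $H(\varphi,m)$.
   Context: A groupoid is a set with one binary operation. A groupoid identity $u=v$ is linear of length $2n$ if the same $n$ variables occur in both terms $u$ and $v$, each exactly once on each side. $\varphi$ implies $\psi$ if every groupoid satisfying $\varphi$ also satisfies $\psi$. A bracketing of length $m$ is a way of parenthesizing a product of $m$ factors (a full ordered binary tree with $m$ leaves). A linear identity $u=v$ of length $2m$ is described by a triple ${}_{i}f_{j}$, where $i$ and $j$ are the bracketings of $u$ and $v$ and $f\in S_m$ is the permutation such that the variable in position $p$ of $u$ is in position $f(p)$ of $v$. Renaming of variables is disregarded, and ${}_{i}f_{j}$ and ${}_{j}(f^{-1})_{i}$ are considered the same identity. The identity-hedron $H(\varphi,m)$ is the following labelled directed graph. Its vertices are the bracketings of length $m$. Consider a word $u_1u_2\cdots u_m$ in $m$ distinct letters, bracketed according to $i$. A single application of $\varphi$ replaces one subterm that is a substitution instance of one of the sides of $\varphi$ (either side) by the corresponding instance of the other side. Every such application, producing a term bracketed according to $j$ in which the letter in position $p$ has moved to position $\pi(p)$, gives an arrow from $i$ to $j$ labelled by $\pi\in S_m$. (Thus arrows come in pairs pointing in opposite directions, with mutually inverse labels.) A journey is a finite (possibly empty) path of consecutive arrows. A journey from $i$ to $j$ along arrows labelled $\pi_1,\dots,\pi_k$, in this order, corresponds to the linear identity ${}_{i}f_{j}$ of length $2m$ with $f=\pi_k\circ\cdots\circ\pi_1$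 (rightmost map applied first; the empty journey at $i$ gives ${}_{i}()_{i}$). *)

theory Defs
  imports "HOL-Library.FuncSet" "HOL-Combinatorics.Permutations" "Graph_Theory.Arc_Walk"
begin

section \<open>Groupoid terms, bracketings and identities\<close>

datatype 'v trm = Var 'v | Op "'v trm" "'v trm"

fun leaves :: "'v trm \<Rightarrow> 'v list" where
  "leaves (Var x) = [x]"
| "leaves (Op s t) = leaves s @ leaves t"

fun subst :: "('v \<Rightarrow> 'w trm) \<Rightarrow> 'v trm \<Rightarrow> 'w trm" where
  "subst \<sigma> (Var x) = \<sigma> x"
| "subst \<sigma> (Op s t) = Op (subst \<sigma> s) (subst \<sigma> t)"

text \<open>A bracketing is a full ordered binary tree without variables; its length is its number of
  leaves.\<close>

type_synonym bracketing = "unit trm"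

definition shape :: "'v trm \<Rightarrow> bracketing" where
  "shape t = map_trm (\<lambda>_. ()) t"

definition bracketings :: "nat \<Rightarrow> bracketing set" where
  "bracketings m = {i. length (leaves i) = m}"

text \<open>The pair \<open>(u, v)\<close> stands for the identity \<open>u = v\<close>; the variables are natural numbers.\<close>

type_synonym identity = "nat trm \<times> nat trm"

definition linear_identity :: "identity \<Rightarrow> bool" where
  "linear_identity \<phi> \<longleftrightarrow>
     distinct (leaves (fst \<phi>)) \<and> distinct (leaves (snd \<phi>)) \<and>
     set (leaves (fst \<phi>)) = set (leaves (snd \<phi>))"

definition identity_length :: "identity \<Rightarrow> nat" where
  "identity_length \<phi> = length (leaves (fst \<phi>)) + length (leaves (snd \<phi>))"


section \<open>Groupoids and implication between identities\<close>

definition groupoid :: "'a set \<Rightarrow> ('a \<Rightarrow> 'a \<Rightarrow> 'a) \<Rightarrow> bool" where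
  "groupoid A f \<longleftrightarrow> f \<in> A \<rightarrow> A \<rightarrow> A"

fun eval :: "('a \<Rightarrow> 'a \<Rightarrow> 'a) \<Rightarrow> ('v \<Rightarrow> 'a) \<Rightarrow> 'v trm \<Rightarrow> 'a" where
  "eval f \<rho> (Var x) = \<rho> x"
| "eval f \<rho> (Op s t) = f (eval f \<rho> s) (eval f \<rho> t)"

definition satisfies :: "'a set \<Rightarrow> ('a \<Rightarrow> 'a \<Rightarrow> 'a) \<Rightarrow> identity \<Rightarrow> bool" where
  "satisfies A f \<phi> \<longleftrightarrow> (\<forall>\<rho> \<in> UNIV \<rightarrow> A. eval f \<rho> (fst \<phi>) = eval f \<rho> (snd \<phi>))"

text \<open>A formula of HOL cannot quantify over types, so the type containing the carriers of the
  groupoids is a parameter. A groupoid may occupy any subset of that type; over an infinite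
  type this includes all finite groupoids.\<close>

definition identity_implies :: "'a itself \<Rightarrow> identity \<Rightarrow> identity \<Rightarrow> bool" where
  "identity_implies _ \<phi> \<psi> \<longleftrightarrow>
     (\<forall>(A :: 'a set) f. groupoid A f \<longrightarrow> satisfies A f \<phi> \<longrightarrow> satisfies A f \<psi>)"


section \<open>Triples describing linear identities\<close>

text \<open>Positions are counted from \<open>0\<close>, so the symmetric group on \<open>m\<close> letters consists of the
  functions \<open>f\<close> with \<open>f permutes {..<m}\<close>.\<close>

type_synonym triple = "bracketing \<times> (nat \<Rightarrow> nat) \<times> bracketing"

definition moves_to :: "'v trm \<Rightarrow> (nat \<Rightarrow> nat) \<Rightarrow> 'v trm \<Rightarrow> bool" where
  "moves_to u f v \<longleftrightarrow>
     f permutes {..<length (leaves u)} \<and> length (leaves v) = length (leaves u) \<and>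
     (\<forall>p < length (leaves u). leaves v ! f p = leaves u ! p)"

fun described_by :: "identity \<Rightarrow> triple \<Rightarrow> bool" where
  "described_by (u, v) (i, f, j) \<longleftrightarrow> shape u = i \<and> shape v = j \<and> moves_to u f v"

text \<open>The triples \<open>(i, f, j)\<close> and \<open>(j, f\<inverse>, i)\<close> count as the same identity.\<close>

fun corresponds_to :: "identity \<Rightarrow> triple \<Rightarrow> bool" where
  "corresponds_to \<psi> (i, f, j) \<longleftrightarrow> described_by \<psi> (i, f, j) \<or> described_by \<psi> (j, inv f, i)"


section \<open>The identity-hedron\<close>

text \<open>A single application of \<open>\<phi>\<close>, in either direction, at one subterm.\<close>

inductive applies :: "identity \<Rightarrow> 'v trm \<Rightarrow> 'v trm \<Rightarrow> bool" for \<phi> where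
  forward: "applies \<phi> (subst \<sigma> (fst \<phi>)) (subst \<sigma> (snd \<phi>))"
| backward: "applies \<phi> (subst \<sigma> (snd \<phi>)) (subst \<sigma> (fst \<phi>))"
| left: "applies \<phi> s s' \<Longrightarrow> applies \<phi> (Op s t) (Op s' t)"
| right: "applies \<phi> t t' \<Longrightarrow> applies \<phi> (Op s t) (Op s t')"

text \<open>An arrow is the triple of its source, label and target. Different applications of \<open>\<phi>\<close> that
  agree in all three components are identified; this does not affect which triples
  journeys yield. The word of \<open>m\<close> distinct letters is \<open>leaves s\<close>.\<close>

definition arrows :: "identity \<Rightarrow> nat \<Rightarrow> triple set" where
  "arrows \<phi> m =
     {(i, \<pi>, j) | i \<pi> j. i \<in> bracketings m \<and> j \<in> bracketings m \<and>
        (\<exists>s t :: nat trm. distinct (leaves s) \<and> shape s = i \<and> shape t = j \<and>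
           applies \<phi> s t \<and> moves_to s \<pi> t)}"

definition identity_hedron :: "identity \<Rightarrow> nat \<Rightarrow> (bracketing, triple) pre_digraph" where
  "identity_hedron \<phi> m =
     \<lparr>verts = bracketings m, arcs = arrows \<phi> m,
      tail = (\<lambda>(i, \<pi>, j). i), head = (\<lambda>(i, \<pi>, j). j)\<rparr>"

definition journey :: "identity \<Rightarrow> nat \<Rightarrow> bracketing \<Rightarrow> triple list \<Rightarrow> bracketing \<Rightarrow> bool" where
  "journey \<phi> m i p j \<longleftrightarrow> pre_digraph.awalk (identity_hedron \<phi> m) i p j"

definition label :: "triple \<Rightarrow> nat \<Rightarrow> nat" where
  "label = (\<lambda>(i, \<pi>, j). \<pi>)"

text \<open>For labels \<open>\<pi>\<^sub>1, \<dots>, \<pi>\<^sub>k\<close> this is \<open>\<pi>\<^sub>k \<circ> \<dots> \<circ> \<pi>\<^sub>1\<close>.\<close>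

definition journey_perm :: "triple list \<Rightarrow> nat \<Rightarrow> nat" where
  "journey_perm p = fold (\<lambda>a f. label a \<circ> f) p id"

definition corresponds_to_journey :: "identity \<Rightarrow> identity \<Rightarrow> nat \<Rightarrow> bool" where
  "corresponds_to_journey \<psi> \<phi> m \<longleftrightarrow>
     (\<exists>i p j. journey \<phi> m i p j \<and> corresponds_to \<psi> (i, journey_perm p, j))"

end

theory Submission
  imports Defs "HOL-Library.Countable"
begin

text \<open>
  Both sides of the equivalence say that the two terms of \<open>\<psi>\<close> are joined by a chain of single
  applications of \<open>\<phi>\<close>. For implication this is Birkhoff's completeness theorem: such chains form
  a congruence, and the quotient of the countable term algebra by it, copied into the infinite type
  at hand, is a groupoid that satisfies \<open>\<phi>\<close> and separates any two terms not joined by a chain.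
  For journeys, linearity of \<open>\<phi>\<close> means that every step of a chain only permutes the letters of a
  linear term, so it is an arrow; conversely an arrow, witnessed on some word of distinct letters,
  can be transported to any word by renaming letters.
\<close>

text \<open>Countability lets terms be coded by natural numbers, and so by elements of any infinite
  type.\<close>

instance trm :: (countable) countable
  by countable_datatype


section \<open>Chains of applications and implication\<close>

lemma subst_Var [simp]: "subst Var t = t"
  by (induction t) auto

lemma map_trm_subst: "map_trm g (subst \<sigma> t) = subst (\<lambda>x. map_trm g (\<sigma> x)) t"
  by (induction t) auto

lemma eval_subst: "eval f \<rho> (subst \<sigma> t) = eval f (\<lambda>x. eval f \<rho> (\<sigma> x)) t"
  by (induction t) auto

lemma eval_closed:
  assumes "groupoid A f" "\<rho> \<in> UNIV \<rightarrow> A"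
  shows "eval f \<rho> t \<in> A"
  using assms by (induction t) (auto simp: groupoid_def Pi_def)

lemma applies_sym: "applies \<phi> s t \<Longrightarrow> applies \<phi> t s"
  by (induction rule: applies.induct) (auto intro: applies.intros)

text \<open>The renaming is absorbed into the substitution, so \<open>g\<close> may even identify
  letters. This makes arrows independent of the word that witnesses them.\<close>

lemma applies_map_trm: "applies \<phi> s t \<Longrightarrow> applies \<phi> (map_trm g s) (map_trm g t)"
  by (induction rule: applies.induct) (auto simp: map_trm_subst intro: applies.intros)

lemma applies_rtranclp_sym: "(applies \<phi>)\<^sup>*\<^sup>* s t \<Longrightarrow> (applies \<phi>)\<^sup>*\<^sup>* t s"
  by (metis applies_sym sympD sympI symp_rtranclp)

lemma applies_rtranclp_Op:
  assumes "(applies \<phi>)\<^sup>*\<^sup>* s s'" "(applies \<phi>)\<^sup>*\<^sup>* t t'"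
  shows "(applies \<phi>)\<^sup>*\<^sup>* (Op s t) (Op s' t')"
proof -
  have "(applies \<phi>)\<^sup>*\<^sup>* (Op s t) (Op s' t)"
    using assms(1) by induction (auto intro: applies.left rtranclp.rtrancl_into_rtrancl)
  also have "(applies \<phi>)\<^sup>*\<^sup>* (Op s' t) (Op s' t')"
    using assms(2) by induction (auto intro: applies.right rtranclp.rtrancl_into_rtrancl)
  finally show ?thesis .
qed

text \<open>Evaluating a substitution instance is evaluating the side of \<phi> itself at the values
  of \<open>\<sigma> x\<close>, which lie in \<open>A\<close> by closure.\<close>

lemma applies_imp_eval_eq:
  assumes "applies \<phi> s t" "groupoid A f" "satisfies A f \<phi>" "\<rho> \<in> UNIV \<rightarrow> A"
  shows "eval f \<rho> s = eval f \<rho> t"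
  using assms(1)
proof (induction rule: applies.induct)
  case (forward \<sigma>)
  then show ?case
    using assms(2-) by (simp add: eval_subst satisfies_def Pi_def eval_closed)
next
  case (backward \<sigma>)
  then show ?case
    using assms(2-) by (simp add: eval_subst satisfies_def Pi_def eval_closed)
qed auto

lemma chain_imp_identity_implies:
  assumes "(applies \<phi>)\<^sup>*\<^sup>* (fst \<psi>) (snd \<psi>)"
  shows "identity_implies TYPE('a) \<phi> \<psi>"
  unfolding identity_implies_def
proof (intro allI impI)
  fix A :: "'a set" and f
  assume A: "groupoid A f" "satisfies A f \<phi>"
  have "eval f \<rho> (fst \<psi>) = eval f \<rho> (snd \<psi>)" if "\<rho> \<in> UNIV \<rightarrow> A" for \<rho>
    using assms by induction (auto dest: applies_imp_eval_eq[OF _ A that])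
  then show "satisfies A f \<psi>"
    by (simp add: satisfies_def)
qed

section \<open>Completeness: the quotient of the term algebra\<close>

lemma identity_implies_imp_chain:
  assumes "infinite (UNIV :: 'a set)" "identity_implies TYPE('a) \<phi> \<psi>"
  shows "(applies \<phi>)\<^sup>*\<^sup>* (fst \<psi>) (snd \<psi>)"
proof -
  let ?R = "(applies \<phi>)\<^sup>*\<^sup>* :: nat trm \<Rightarrow> nat trm \<Rightarrow> bool"
  \<comment> \<open>A class of the quotient is represented by a chosen member. The choice depends on
    \<open>t\<close> only through the predicate \<open>?R t\<close>, so terms joined by a chain get
    the same representative.\<close>
  define rep where "rep t = (SOME s. ?R t s)" for t
  have rep: "?R t (rep t)" for t
    unfolding rep_def by (rule someI) (rule rtranclp.rtrancl_refl)
  have rep_eq_iff: "rep s = rep t \<longleftrightarrow> ?R s t" for s t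
  proof
    assume "rep s = rep t"
    then show "?R s t"
      using rep[of s] applies_rtranclp_sym[OF rep[of t]] by simp
  next
    assume "?R s t"
    then have "?R s = ?R t"
      by (intro ext) (meson applies_rtranclp_sym rtranclp_trans)
    then show "rep s = rep t"
      by (simp add: rep_def)
  qed
  obtain g :: "nat \<Rightarrow> 'a" where "inj g"
    using assms(1) infinite_countable_subset by blast
  define e where "e = g \<circ> (to_nat :: nat trm \<Rightarrow> nat)"
  have e: "inj e"
    unfolding e_def using \<open>inj g\<close> inj_to_nat by (rule inj_compose)
  define A where "A = range (e \<circ> rep)"
  \<comment> \<open>Decode, multiply as terms, pass to the representative, encode. The value lies in
    \<open>A\<close> for all arguments, even where \<open>inv e\<close> is arbitrary.\<close>
  define f where "f x y = e (rep (Op (inv e x) (inv e y)))" for x y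
  \<comment> \<open>A valuation in the quotient lifts to a substitution, and evaluation then yields
    the class of the substituted term; the congruence property gives the product case.\<close>
  have eval: "eval f (\<lambda>x. e (rep (\<sigma> x))) t = e (rep (subst \<sigma> t))" for \<sigma> and t :: "nat trm"
  proof (induction t)
    case (Op s t)
    have "rep (Op (rep (subst \<sigma> s)) (rep (subst \<sigma> t))) = rep (Op (subst \<sigma> s) (subst \<sigma> t))"
      unfolding rep_eq_iff by (intro applies_rtranclp_Op applies_rtranclp_sym[OF rep])
    with Op e show ?case
      by (simp add: f_def)
  qed auto
  have "groupoid A f"
    by (auto simp: groupoid_def A_def f_def)
  moreover have "satisfies A f \<phi>"
    unfolding satisfies_def
  proof
    fix \<rho> :: "nat \<Rightarrow> 'a"
    assume "\<rho> \<in> UNIV \<rightarrow> A"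
    then have "\<forall>x. \<exists>t. \<rho> x = e (rep t)"
      by (auto simp: A_def)
    then obtain \<sigma> where "\<rho> = (\<lambda>x. e (rep (\<sigma> x)))"
      by metis
    moreover have "rep (subst \<sigma> (fst \<phi>)) = rep (subst \<sigma> (snd \<phi>))"
      unfolding rep_eq_iff by (intro r_into_rtranclp applies.forward)
    ultimately show "eval f \<rho> (fst \<phi>) = eval f \<rho> (snd \<phi>)"
      by (simp add: eval)
  qed
  ultimately have "satisfies A f \<psi>"
    using assms(2) by (simp add: identity_implies_def)
  \<comment> \<open>The generic valuation sends each variable to its own class, so each side of
    \<psi> evaluates to its own class.\<close>
  then have "eval f (\<lambda>x. e (rep (Var x))) (fst \<psi>) = eval f (\<lambda>x. e (rep (Var x))) (snd \<psi>)"
    by (simp add: satisfies_def A_def)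
  then show ?thesis
    using e by (simp add: eval inj_eq rep_eq_iff)
qed


section \<open>Chains of applications and journeys\<close>

lemma length_leaves_shape: "length (leaves (shape t)) = length (leaves t)"
  by (induction t) (auto simp: shape_def)

lemma leaves_map_trm: "leaves (map_trm g t) = map g (leaves t)"
  by (induction t) auto

lemma shape_map_trm: "shape (map_trm g t) = shape t"
  by (induction t) (auto simp: shape_def)

text \<open>Equal shapes cut the common word of leaves at the same place, so the induction descends
  into both factors.\<close>

lemma trm_eqI: "shape s = shape t \<Longrightarrow> leaves s = leaves t \<Longrightarrow> s = t"
proof (induction s arbitrary: t)
  case (Var x)
  then show ?case by (cases t) (auto simp: shape_def)
next
  case (Op s1 s2)
  then obtain t1 t2 where t: "t = Op t1 t2"
    by (cases t) (auto simp: shape_def)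
  with Op.prems have sh: "shape s1 = shape t1" "shape s2 = shape t2"
    by (auto simp: shape_def)
  then have "length (leaves s1) = length (leaves t1)"
    by (metis length_leaves_shape)
  then have "leaves s1 = leaves t1" "leaves s2 = leaves t2"
    using Op.prems(2) t by auto
  then have "s1 = t1" "s2 = t2"
    using Op.IH sh by blast+
  with t show ?case by simp
qed

text \<open>Distinct leaves of \<open>s\<close> make the position-wise pairing with the leaves of
  \<open>t\<close> a function, even if letters repeat in \<open>t\<close>.\<close>

lemma same_shape_imp_renaming:
  assumes "distinct (leaves s)" "shape s = shape t"
  obtains g where "t = map_trm g s"
proof
  have len: "length (leaves s) = length (leaves t)"
    using assms(2) by (metis length_leaves_shape)
  let ?g = "\<lambda>x. the (map_of (zip (leaves s) (leaves t)) x)"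
  have "map ?g (leaves s) = leaves t"
    using assms(1) len by (intro nth_equalityI) (auto simp: map_of_zip_nth)
  then show "t = map_trm ?g s"
    using assms(2) by (simp add: trm_eqI shape_map_trm leaves_map_trm)
qed

lemma mset_leaves_subst:
  "mset (leaves (subst \<sigma> t)) = (\<Sum>x\<in>#mset (leaves t). mset (leaves (\<sigma> x)))"
  by (induction t) auto

text \<open>Linearity gives both sides of \<phi> the same multiset of variables, and the letters of
  an instance depend only on that multiset and \<open>\<sigma>\<close>.\<close>

lemma applies_mset_leaves:
  assumes "linear_identity \<phi>" "applies \<phi> s t"
  shows "mset (leaves s) = mset (leaves t)"
proof -
  have "mset (leaves (fst \<phi>)) = mset (leaves (snd \<phi>))"
    using assms(1) set_eq_iff_mset_eq_distinct unfolding linear_identity_def by blast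
  with assms(2) show ?thesis
    by (induction rule: applies.induct) (auto simp: mset_leaves_subst)
qed

lemma moves_to_exists:
  assumes "mset (leaves s) = mset (leaves t)"
  obtains \<pi> where "moves_to s \<pi> t"
proof -
  \<comment> \<open>The roles are swapped on purpose: \<open>permute_list\<close> reads position
    \<open>\<pi> p\<close> of \<open>t\<close> for position \<open>p\<close> of \<open>s\<close>,
    which is the direction of \<open>moves_to s \<pi> t\<close>.\<close>
  obtain \<pi> where \<pi>: "\<pi> permutes {..<length (leaves t)}" "permute_list \<pi> (leaves t) = leaves s"
    using assms by (rule mset_eq_permutation)
  have len: "length (leaves t) = length (leaves s)"
    using assms by (metis size_mset)
  have "moves_to s \<pi> t"
    using \<pi> len permute_list_nth[OF \<pi>(1)] by (simp add: moves_to_def)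
  then show thesis ..
qed

section \<open>Composition and inversion of letter movements\<close>

lemma moves_to_permutes: "moves_to s f t \<Longrightarrow> f permutes {..<length (leaves s)}"
  by (simp add: moves_to_def)

lemma moves_to_length: "moves_to s f t \<Longrightarrow> length (leaves t) = length (leaves s)"
  by (simp add: moves_to_def)

lemma moves_to_id: "moves_to s id s"
  by (simp add: moves_to_def permutes_id)

lemma moves_to_id_imp_eq: "moves_to s id t \<Longrightarrow> shape s = shape t \<Longrightarrow> s = t"
  by (rule trm_eqI) (auto simp: moves_to_def intro: nth_equalityI)

lemma moves_to_comp:
  assumes "moves_to s f t" "moves_to t g u"
  shows "moves_to s (g \<circ> f) u"
  unfolding moves_to_def
proof (intro conjI allI impI)
  show "g \<circ> f permutes {..<length (leaves s)}"
    using assms by (auto simp: moves_to_def intro: permutes_compose)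
  show "length (leaves u) = length (leaves s)"
    using assms by (simp add: moves_to_def)
  fix p assume p: "p < length (leaves s)"
  then have "f p < length (leaves s)"
    using permutes_in_image[OF moves_to_permutes[OF assms(1)], of p] by simp
  with p show "leaves u ! (g \<circ> f) p = leaves s ! p"
    using assms by (simp add: moves_to_def)
qed

lemma moves_to_inv:
  assumes "moves_to s f t"
  shows "moves_to t (inv f) s"
  unfolding moves_to_def
proof (intro conjI allI impI)
  note f = moves_to_permutes[OF assms]
  show "inv f permutes {..<length (leaves t)}" "length (leaves s) = length (leaves t)"
    using f permutes_inv moves_to_length[OF assms] by auto
  fix p assume "p < length (leaves t)"
  then have "inv f p < length (leaves s)"
    using permutes_in_image[OF permutes_inv[OF f], of p] moves_to_length[OF assms] by simp
  then show "leaves s ! inv f p = leaves t ! p"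
    using assms permutes_inverses(1)[OF f, of p] unfolding moves_to_def by fastforce
qed

lemma moves_to_map_trm: "moves_to s f t \<Longrightarrow> moves_to (map_trm g s) f (map_trm g t)"
  unfolding moves_to_def leaves_map_trm
  by (metis length_map lessThan_iff nth_map permutes_in_image)

section \<open>Journeys, their permutations and their chains\<close>

lemma journey_Nil: "journey \<phi> m i [] j \<longleftrightarrow> i \<in> bracketings m \<and> i = j"
  by (auto simp: journey_def pre_digraph.awalk_def pre_digraph.cas.simps identity_hedron_def)

lemma journey_Cons:
  "journey \<phi> m i (a # p) j \<longleftrightarrow>
     (\<exists>\<pi> k. a = (i, \<pi>, k) \<and> a \<in> arrows \<phi> m \<and> journey \<phi> m k p j)"
  by (cases a)
    (auto simp: journey_def pre_digraph.awalk_def pre_digraph.cas.simps identity_hedron_def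
      arrows_def)

lemma journey_snoc:
  assumes "journey \<phi> m i p j" "(j, \<pi>, k) \<in> arrows \<phi> m"
  shows "journey \<phi> m i (p @ [(j, \<pi>, k)]) k"
  using assms
proof (induction p arbitrary: i)
  case Nil
  then show ?case by (auto simp: journey_Nil journey_Cons arrows_def)
next
  case (Cons a p)
  then show ?case by (auto simp: journey_Cons)
qed

lemma journey_perm_Nil: "journey_perm [] = id"
  by (simp add: journey_perm_def)

lemma journey_perm_snoc: "journey_perm (p @ [a]) = label a \<circ> journey_perm p"
  by (simp add: journey_perm_def)

text \<open>The fold composes each later label on the left, so appending an arrow is immediate,
  while prepending one takes an induction from the end of the list.\<close>

lemma journey_perm_Cons: "journey_perm (a # p) = journey_perm p \<circ> label a"
  by (induction p rule: rev_induct)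
    (simp_all add: journey_perm_Nil journey_perm_snoc comp_assoc flip: append_Cons,
     simp add: journey_perm_def)

lemma arrow_permutes: "(i, \<pi>, j) \<in> arrows \<phi> m \<Longrightarrow> \<pi> permutes {..<m}"
  by (auto simp: arrows_def bracketings_def moves_to_def length_leaves_shape)

text \<open>Bijectivity lets a double \<open>inv\<close> cancel when an identity is described by the
  reversed triple.\<close>

lemma journey_perm_permutes: "journey \<phi> m i p j \<Longrightarrow> journey_perm p permutes {..<m}"
proof (induction p arbitrary: i)
  case Nil
  then show ?case
    unfolding journey_perm_Nil by (intro permutes_id)
next
  case (Cons a p)
  then obtain \<pi> k where "a = (i, \<pi>, k)" "(i, \<pi>, k) \<in> arrows \<phi> m" "journey \<phi> m k p j"
    by (auto simp: journey_Cons)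
  with Cons.IH show ?case
    unfolding journey_perm_Cons by (intro permutes_compose) (auto simp: label_def arrow_permutes)
qed

text \<open>An arrow is witnessed on a single word of distinct letters; renaming that word carries
  the application over to \<open>s\<close>, whose letters may repeat.\<close>

lemma arrow_imp_applies:
  assumes "(shape s, \<pi>, k) \<in> arrows \<phi> m"
  obtains t where "applies \<phi> s t" "moves_to s \<pi> t" "shape t = k"
proof -
  obtain s\<^sub>0 t\<^sub>0 :: "nat trm" where
    *: "distinct (leaves s\<^sub>0)" "shape s\<^sub>0 = shape s" "shape t\<^sub>0 = k"
      "applies \<phi> s\<^sub>0 t\<^sub>0" "moves_to s\<^sub>0 \<pi> t\<^sub>0"
    using assms by (auto simp: arrows_def)
  obtain g where "s = map_trm g s\<^sub>0"
    using *(1,2) by (rule same_shape_imp_renaming)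
  then show thesis
    using that[of "map_trm g t\<^sub>0"] *
    by (simp add: applies_map_trm moves_to_map_trm shape_map_trm)
qed

text \<open>Follow the arrows from \<open>s\<close>. The final term has the shape of
  \<open>t\<close> and its letters in the same positions, hence is \<open>t\<close>.\<close>

lemma journey_imp_chain:
  assumes "journey \<phi> m (shape s) p (shape t)" "moves_to s (journey_perm p) t"
  shows "(applies \<phi>)\<^sup>*\<^sup>* s t"
  using assms
proof (induction p arbitrary: s)
  case Nil
  then have "s = t"
    unfolding journey_Nil journey_perm_Nil by (blast intro: moves_to_id_imp_eq)
  then show ?case by simp
next
  case (Cons a p)
  then obtain \<pi> k where a: "a = (shape s, \<pi>, k)" "a \<in> arrows \<phi> m"
    and p: "journey \<phi> m k p (shape t)"
    by (auto simp: journey_Cons)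
  then obtain s' where s': "applies \<phi> s s'" "moves_to s \<pi> s'" "shape s' = k"
    using arrow_imp_applies by metis
  \<comment> \<open>Going back along the first arrow and then along the whole journey leaves the
    movement of the remaining arrows.\<close>
  have "moves_to s' ((journey_perm p \<circ> \<pi>) \<circ> inv \<pi>) t"
    using moves_to_comp[OF moves_to_inv[OF s'(2)] Cons.prems(2)]
    unfolding journey_perm_Cons label_def a(1) prod.case .
  then have "moves_to s' (journey_perm p) t"
    unfolding comp_assoc permutes_inv_o(1)[OF moves_to_permutes[OF s'(2)]] by simp
  then have "(applies \<phi>)\<^sup>*\<^sup>* s' t"
    using Cons.IH p s'(3) by simp
  with s'(1) show ?case by (rule converse_rtranclp_into_rtranclp)
qed

text \<open>Each step of the chain appends one arrow. Its witness is the current term itself, whose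
  letters stay distinct because linear applications preserve their multiset.\<close>

lemma chain_imp_journey:
  fixes s t :: "nat trm"
  assumes "linear_identity \<phi>" "(applies \<phi>)\<^sup>*\<^sup>* s t" "distinct (leaves s)"
  shows "\<exists>p. journey \<phi> (length (leaves s)) (shape s) p (shape t) \<and>
    moves_to s (journey_perm p) t"
  using assms(2)
proof induction
  case base
  have "journey \<phi> (length (leaves s)) (shape s) [] (shape s)"
    by (simp add: journey_Nil bracketings_def length_leaves_shape)
  moreover have "moves_to s (journey_perm []) s"
    unfolding journey_perm_Nil by (rule moves_to_id)
  ultimately show ?case by blast
next
  case (step t u)
  then obtain p where p: "journey \<phi> (length (leaves s)) (shape s) p (shape t)"
      "moves_to s (journey_perm p) t"
    by blast
  have "mset (leaves s) = mset (leaves t)"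
    using step.hyps(1) by induction (auto dest: applies_mset_leaves[OF assms(1)])
  then have distinct: "distinct (leaves t)"
    using assms(3) mset_eq_imp_distinct_iff by blast
  obtain \<pi> where \<pi>: "moves_to t \<pi> u"
    using applies_mset_leaves[OF assms(1) step.hyps(2)] by (rule moves_to_exists)
  have "(shape t, \<pi>, shape u) \<in> arrows \<phi> (length (leaves s))"
    using \<pi> distinct step.hyps(2) moves_to_length[OF p(2)] moves_to_length[OF \<pi>]
    by (auto simp: arrows_def bracketings_def length_leaves_shape)
  note journey_snoc[OF p(1) this]
  moreover have "moves_to s (journey_perm (p @ [(shape t, \<pi>, shape u)])) u"
    using moves_to_comp[OF p(2) \<pi>] unfolding journey_perm_snoc label_def by simp
  ultimately show ?case by blast
qed

lemma corresponds_to_journey_iff_chain: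
  assumes "linear_identity \<phi>" "linear_identity \<psi>" "identity_length \<psi> = 2 * m"
  shows "corresponds_to_journey \<psi> \<phi> m \<longleftrightarrow> (applies \<phi>)\<^sup>*\<^sup>* (fst \<psi>) (snd \<psi>)"
proof
  assume "corresponds_to_journey \<psi> \<phi> m"
  then obtain i p j where p: "journey \<phi> m i p j" and "corresponds_to \<psi> (i, journey_perm p, j)"
    by (auto simp: corresponds_to_journey_def)
  then consider "described_by \<psi> (i, journey_perm p, j)"
    | "described_by \<psi> (j, inv (journey_perm p), i)"
    by auto
  then show "(applies \<phi>)\<^sup>*\<^sup>* (fst \<psi>) (snd \<psi>)"
  proof cases
    case 1
    then show ?thesis
      using p by (cases \<psi>) (auto intro: journey_imp_chain)
  next
    case 2
    \<comment> \<open>Here the journey runs from the right side of \<psi> to the left side, so the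
      chain it yields has to be reversed.\<close>
    then have "moves_to (snd \<psi>) (inv (inv (journey_perm p))) (fst \<psi>)"
      by (cases \<psi>) (auto intro: moves_to_inv)
    then have "moves_to (snd \<psi>) (journey_perm p) (fst \<psi>)"
      using permutes_inv_inv[OF journey_perm_permutes[OF p]] by simp
    then have "(applies \<phi>)\<^sup>*\<^sup>* (snd \<psi>) (fst \<psi>)"
      using 2 p by (cases \<psi>) (auto intro: journey_imp_chain)
    then show ?thesis by (rule applies_rtranclp_sym)
  qed
next
  assume chain: "(applies \<phi>)\<^sup>*\<^sup>* (fst \<psi>) (snd \<psi>)"
  have distinct: "distinct (leaves (fst \<psi>))"
    using assms(2) by (simp add: linear_identity_def)
  \<comment> \<open>Both sides list the same variables without repetition, so each takes half of the
    total length \<open>2 * m\<close>.\<close>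
  have "length (leaves (fst \<psi>)) = length (leaves (snd \<psi>))"
    using assms(2) by (metis linear_identity_def distinct_card)
  then have "length (leaves (fst \<psi>)) = m"
    using assms(3) by (simp add: identity_length_def)
  with chain_imp_journey[OF assms(1) chain distinct] obtain p
    where "journey \<phi> m (shape (fst \<psi>)) p (shape (snd \<psi>))"
      "moves_to (fst \<psi>) (journey_perm p) (snd \<psi>)"
    by blast
  moreover from this(2)
  have "corresponds_to \<psi> (shape (fst \<psi>), journey_perm p, shape (snd \<psi>))"
    by (cases \<psi>) simp
  ultimately show "corresponds_to_journey \<psi> \<phi> m"
    unfolding corresponds_to_journey_def by (intro exI conjI)
qed

theorem theorem3p2:
  fixes \<phi> \<psi> :: identity and m :: nat
  assumes "infinite (UNIV :: 'a set)"
    and "linear_identity \<phi>" and "linear_identity \<psi>"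
    and "identity_length \<psi> = 2 * m"
  shows "identity_implies TYPE('a) \<phi> \<psi> \<longleftrightarrow> corresponds_to_journey \<psi> \<phi> m"
  using corresponds_to_journey_iff_chain[OF assms(2-4)]
    identity_implies_imp_chain[OF assms(1)] chain_imp_identity_implies
  by blast

end
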